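(* Let $\mathcal{M}$ be a factor and let $A,B\in\mathcal{M}$. If $UAU^{*}B=BUAU^{*}$ holds for every $U\in\mathscr{U}(\mathcal{M})$, then either $A$ or $B$ is in $\mathbb{C}I$.
   Context: A von Neumann algebra $\mathcal{M}$ on a Hilbert space $\mathscr{H}$ is a unital weak-operator-closed $*$-subalgebra of $B(\mathscr{H})$. It is a factor if $\mathcal{M}\cap\mathcal{M}'=\mathbb{C}I$, where $I$ is the identity of $\mathcal{M}$. $\mathscr{U}(\mathcal{M})$ denotes the set of all unitary operators in $\mathcal{M}$. All factors are assumed to have separable predual. *)

theory Defs
  imports "HOL-Analysis.Analysis"
begin

section \<open>Complex Hilbert spaces\<close>

text \<open>The inner product is linear in the first argument and conjugate-linear in the second.
  Completeness and the real normed structure come from the class \<^class>\<open>banach\<close>; the last axiom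
  says that the norm is the one induced by the inner product (and so contains positivity and
  definiteness). No separability of the space is required.\<close>

class complex_hilbert = banach +
  fixes scaleC :: "complex \<Rightarrow> 'a \<Rightarrow> 'a" (infixr "*\<^sub>C" 75)
    and cinner :: "'a \<Rightarrow> 'a \<Rightarrow> complex"
  assumes scaleC_add_right: "c *\<^sub>C (x + y) = c *\<^sub>C x + c *\<^sub>C y"
    and scaleC_add_left: "(c + d) *\<^sub>C x = c *\<^sub>C x + d *\<^sub>C x"
    and scaleC_scaleC: "c *\<^sub>C (d *\<^sub>C x) = (c * d) *\<^sub>C x"
    and scaleC_of_real: "complex_of_real r *\<^sub>C x = r *\<^sub>R x"
    and cinner_commute: "cinner x y = cnj (cinner y x)"
    and cinner_add_left: "cinner (x + y) z = cinner x z + cinner y z"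
    and cinner_scaleC_left: "cinner (c *\<^sub>C x) y = c * cinner x y"
    and cinner_self: "cinner x x = complex_of_real ((norm x)\<^sup>2)"

lemma norm_scaleC: "norm (c *\<^sub>C x) = cmod c * norm (x :: 'a :: complex_hilbert)"
proof -
  have "cinner x (c *\<^sub>C x) = cnj c * cinner x x"
    by (metis cinner_commute cinner_scaleC_left complex_cnj_mult)
  then have "complex_of_real ((norm (c *\<^sub>C x))\<^sup>2) = (c * cnj c) * cinner x x"
    by (metis cinner_self cinner_scaleC_left mult.assoc)
  also have "\<dots> = complex_of_real ((cmod c * norm x)\<^sup>2)"
    unfolding cinner_self complex_norm_square[symmetric] by (simp add: power_mult_distrib)
  finally have "(norm (c *\<^sub>C x))\<^sup>2 = (cmod c * norm x)\<^sup>2"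
    using of_real_eq_iff by blast
  then show ?thesis
    by simp
qed

instantiation complex :: complex_hilbert
begin

definition scaleC_complex :: "complex \<Rightarrow> complex \<Rightarrow> complex"
  where "scaleC_complex c x = c * x"

definition cinner_complex :: "complex \<Rightarrow> complex \<Rightarrow> complex"
  where "cinner_complex x y = x * cnj y"

instance
proof
  fix x :: complex
  show "cinner x x = complex_of_real ((norm x)\<^sup>2)"
    unfolding cinner_complex_def by (simp only: complex_norm_square)
qed (simp_all add: scaleC_complex_def cinner_complex_def algebra_simps scaleR_conv_of_real)

end

section \<open>Bounded operators\<close>

text \<open>The library's type of bounded linear maps consists of the real-linear ones; \<open>B(H)\<close> is the set
  of those that are complex-linear. The library norm is the operator norm.\<close>

definition bounded_operators :: "('h :: complex_hilbert \<Rightarrow>\<^sub>L 'h) set"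
  where "bounded_operators = {T :: 'h \<Rightarrow>\<^sub>L 'h. \<forall>c x. T (c *\<^sub>C x) = c *\<^sub>C T x}"

lift_definition scaleC_op :: "complex \<Rightarrow> ('h :: complex_hilbert \<Rightarrow>\<^sub>L 'h) \<Rightarrow> 'h \<Rightarrow>\<^sub>L 'h"
  is "\<lambda>c T x. c *\<^sub>C T x"
proof -
  fix c and T :: "'h \<Rightarrow> 'h"
  assume T: "bounded_linear T"
  have "bounded_linear (\<lambda>x :: 'h. c *\<^sub>C x)"
  proof (rule bounded_linear_intro)
    show "c *\<^sub>C (x + y) = c *\<^sub>C x + c *\<^sub>C y" for x y :: 'h
      by (rule scaleC_add_right)
    show "c *\<^sub>C (r *\<^sub>R x) = r *\<^sub>R (c *\<^sub>C x)" for r and x :: 'h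
      unfolding scaleC_of_real[symmetric] scaleC_scaleC by (simp add: mult.commute)
    show "norm (c *\<^sub>C x) \<le> norm x * cmod c" for x :: 'h
      by (simp add: norm_scaleC mult.commute)
  qed
  from bounded_linear_compose[OF this T] show "bounded_linear (\<lambda>x. c *\<^sub>C T x)" .
qed

definition scalar_operators :: "('h :: complex_hilbert \<Rightarrow>\<^sub>L 'h) set"
  where "scalar_operators = range (\<lambda>c. scaleC_op c id_blinfun)"

text \<open>For \<open>T\<close> in \<open>B(H)\<close> the adjoint exists by the Riesz representation theorem, it is unique, and it
  is automatically complex-linear.\<close>

definition cadjoint :: "('h :: complex_hilbert \<Rightarrow>\<^sub>L 'h) \<Rightarrow> 'h \<Rightarrow>\<^sub>L 'h"
  where "cadjoint T = (THE S :: 'h \<Rightarrow>\<^sub>L 'h. \<forall>x y. cinner (T x) y = cinner x (S y))"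

definition commutant :: "('h :: complex_hilbert \<Rightarrow>\<^sub>L 'h) set \<Rightarrow> ('h \<Rightarrow>\<^sub>L 'h) set"
  where "commutant M = {T \<in> bounded_operators. \<forall>S\<in>M. T o\<^sub>L S = S o\<^sub>L T}"

text \<open>The weak operator topology on \<open>B(H)\<close>: the coarsest one for which all functionals
  \<open>T \<mapsto> \<langle>T x, y\<rangle>\<close> are continuous.\<close>

definition weak_operator_topology :: "('h :: complex_hilbert \<Rightarrow>\<^sub>L 'h) topology"
  where "weak_operator_topology = topology_generated_by
    {{T \<in> bounded_operators. cinner (T x) y \<in> W} | x y W. open W}"

section \<open>Von Neumann algebras and factors\<close>

definition von_neumann_algebra :: "('h :: complex_hilbert \<Rightarrow>\<^sub>L 'h) set \<Rightarrow> bool"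
  where "von_neumann_algebra M \<longleftrightarrow>
    M \<subseteq> bounded_operators \<and>
    id_blinfun \<in> M \<and>
    (\<forall>S\<in>M. \<forall>T\<in>M. S + T \<in> M) \<and>
    (\<forall>c. \<forall>T\<in>M. scaleC_op c T \<in> M) \<and>
    (\<forall>S\<in>M. \<forall>T\<in>M. S o\<^sub>L T \<in> M) \<and>
    (\<forall>T\<in>M. cadjoint T \<in> M) \<and>
    closedin weak_operator_topology M"

definition factor :: "('h :: complex_hilbert \<Rightarrow>\<^sub>L 'h) set \<Rightarrow> bool"
  where "factor M \<longleftrightarrow> von_neumann_algebra M \<and> M \<inter> commutant M = scalar_operators"

definition unitaries :: "('h :: complex_hilbert \<Rightarrow>\<^sub>L 'h) set \<Rightarrow> ('h \<Rightarrow>\<^sub>L 'h) set"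
  where "unitaries M = {U \<in> M. cadjoint U o\<^sub>L U = id_blinfun \<and> U o\<^sub>L cadjoint U = id_blinfun}"

section \<open>The predual\<close>

text \<open>The ultraweak topology on \<open>B(H)\<close>: the coarsest one for which all functionals
  \<open>T \<mapsto> \<Sum>n. \<langle>T x\<^sub>n, y\<^sub>n\<rangle>\<close> with square-summable \<open>x\<close> and \<open>y\<close> are continuous (these series converge
  absolutely).\<close>

definition ultraweak_topology :: "('h :: complex_hilbert \<Rightarrow>\<^sub>L 'h) topology"
  where "ultraweak_topology = topology_generated_by
    {{T \<in> bounded_operators. (\<Sum>n. cinner (T (x n)) (y n)) \<in> W} | x y W.
      summable (\<lambda>n :: nat. (norm (x n))\<^sup>2) \<and> summable (\<lambda>n. (norm (y n))\<^sup>2) \<and> open W}"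

text \<open>The predual of \<open>M\<close> is the space of ultraweakly continuous linear functionals on \<open>M\<close>, with the
  norm of the dual of \<open>M\<close>. Functionals on \<open>M\<close> are represented by functions that are
  \<^term>\<open>undefined\<close> outside \<open>M\<close>.\<close>

definition predual :: "('h :: complex_hilbert \<Rightarrow>\<^sub>L 'h) set \<Rightarrow> (('h \<Rightarrow>\<^sub>L 'h) \<Rightarrow> complex) set"
  where "predual M = {\<phi> \<in> extensional M.
    (\<forall>S\<in>M. \<forall>T\<in>M. \<phi> (S + T) = \<phi> S + \<phi> T) \<and>
    (\<forall>c. \<forall>T\<in>M. \<phi> (scaleC_op c T) = c * \<phi> T) \<and>
    continuous_map (subtopology ultraweak_topology M) euclidean \<phi>}"

text \<open>On ultraweakly continuous functionals, which are norm bounded, the supremum is finite.\<close>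

definition functional_norm ::
    "('h :: complex_hilbert \<Rightarrow>\<^sub>L 'h) set \<Rightarrow> (('h \<Rightarrow>\<^sub>L 'h) \<Rightarrow> complex) \<Rightarrow> real"
  where "functional_norm M \<phi> = (SUP T\<in>{T \<in> M. norm T \<le> 1}. cmod (\<phi> T))"

definition separable_predual :: "('h :: complex_hilbert \<Rightarrow>\<^sub>L 'h) set \<Rightarrow> bool"
  where "separable_predual M \<longleftrightarrow>
    (\<exists>D. countable D \<and> D \<subseteq> predual M \<and>
      (\<forall>\<phi>\<in>predual M. \<forall>e>0. \<exists>\<psi>\<in>D. functional_norm M (\<lambda>T. \<phi> T - \<psi> T) < e))"

end

theory Submission
  imports Defs
begin

text \<open>
  The condition on all unitaries is differentiated at the identity. A skew-adjoint \<open>K\<close> in \<open>M\<close> is the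
  velocity, up to a factor 2, of the curve of Cayley transforms \<open>U = (I + t K) (I - t K)\<^sup>-\<^sup>1\<close> in the
  unitary group of \<open>M\<close>, and the first order term of \<open>[U A U\<^sup>*, B] = 0\<close> is \<open>[[K, A], B] = 0\<close>. The
  skew-adjoint operators span \<open>M\<close> over the complex numbers, so the two inner derivations \<open>ad A\<close> and
  \<open>ad B\<close> of \<open>M\<close> satisfy \<open>ad B \<circ> ad A = 0\<close> (\<open>ad_ad_eq_0\<close>).

  What remains is algebra: by a theorem of Posner, whose short proof is repeated in \<open>posner\<close>, in a
  prime ring without 2-torsion a product of two derivations vanishes only if one of them does.
  Then \<open>A\<close> or \<open>B\<close> is central, hence a scalar.

  A factor is prime: if \<open>a M b = 0\<close> and \<open>b \<noteq> 0\<close> then \<open>a = 0\<close> (\<open>factor_prime\<close>). Indeed the projection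
  onto the closed span of \<open>M b H\<close> is central and nonzero, so it is the identity, while \<open>a\<close> vanishes on
  this subspace. That the projection belongs to \<open>M\<close> is shown directly in \<open>range_projection_mem\<close>,
  without the bicommutant theorem, as a weak limit of operators \<open>h (h + e)\<^sup>-\<^sup>1\<close> with \<open>h\<close> a finite sum
  \<open>\<Sum>x x\<^sup>*\<close>.

  Both parts invert operators within \<open>M\<close>, namely \<open>I - t K\<close> and \<open>h + e\<close>. Each is coercive, and
  \<open>coercive_invertible\<close> obtains the inverse from the contraction principle in \<open>M\<close>. Adjoints and
  projections come from the Riesz representation theorem on closed subspaces.
\<close>

section \<open>Elementary Hilbert space geometry\<close>

lemma cinner_add_right: "cinner x (y + z) = cinner x y + cinner x (z :: 'h :: complex_hilbert)"
  by (metis cinner_commute cinner_add_left complex_cnj_add)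

lemma cinner_scaleC_right: "cinner x (c *\<^sub>C y) = cnj c * cinner x (y :: 'h :: complex_hilbert)"
  by (metis cinner_commute cinner_scaleC_left complex_cnj_mult)

lemma cinner_scaleR_left: "cinner (r *\<^sub>R x) y = r *\<^sub>R cinner x (y :: 'h :: complex_hilbert)"
  by (metis scaleC_of_real cinner_scaleC_left scaleR_conv_of_real)

lemma cinner_scaleR_right: "cinner x (r *\<^sub>R y) = r *\<^sub>R cinner x (y :: 'h :: complex_hilbert)"
  by (metis scaleC_of_real cinner_scaleC_right scaleR_conv_of_real complex_cnj_complex_of_real)

lemma power2_norm_add:
  "(norm (x + y))\<^sup>2 = (norm x)\<^sup>2 + 2 * Re (cinner x y) + (norm (y :: 'h :: complex_hilbert))\<^sup>2"
proof -
  have "cinner (x + y) (x + y) = cinner x x + cinner x y + cnj (cinner x y) + cinner y y"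
    using cinner_commute[of y x] by (simp add: cinner_add_left cinner_add_right)
  then have "Re (cinner (x + y) (x + y)) = Re (cinner x x + cinner x y + cnj (cinner x y) + cinner y y)"
    by simp
  then show ?thesis
    by (simp add: cinner_self)
qed

text \<open>The triangle inequality is already part of the normed structure; squaring it gives the
  Cauchy--Schwarz inequality for the real part, and a rotation of \<open>x\<close> gives it for the modulus.\<close>

lemma cmod_cinner_le: "cmod (cinner x y) \<le> norm x * norm (y :: 'h :: complex_hilbert)"
proof (cases "cinner x y = 0")
  case False
  define c where "c = cnj (cinner x y) / cmod (cinner x y)"
  have "cmod c = 1"
    using False by (simp add: c_def norm_divide)
  have "c * cinner x y = cmod (cinner x y)"
    using False complex_norm_square[of "cinner x y"]
    by (simp add: c_def field_simps power2_eq_square)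
  then have "cmod (cinner x y) = Re (cinner (c *\<^sub>C x) y)"
    by (simp add: cinner_scaleC_left)
  also have "\<dots> \<le> norm (c *\<^sub>C x) * norm y"
  proof -
    have "(norm (c *\<^sub>C x + y))\<^sup>2 \<le> (norm (c *\<^sub>C x) + norm y)\<^sup>2"
      by (intro power_mono norm_triangle_ineq) simp
    then show ?thesis
      unfolding power2_norm_add by (simp add: power2_sum)
  qed
  finally show ?thesis
    using \<open>cmod c = 1\<close> by (simp add: norm_scaleC)
qed simp

interpretation cinner: bounded_bilinear "cinner :: 'h :: complex_hilbert \<Rightarrow> _"
proof
  show "\<exists>K. \<forall>a b :: 'h. norm (cinner a b) \<le> norm a * norm b * K"
    by (rule exI[of _ 1]) (simp add: cmod_cinner_le)
qed (simp_all add: cinner_add_left cinner_add_right cinner_scaleR_left cinner_scaleR_right)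

lemma Re_cinner_le: "Re (cinner x y) \<le> norm x * norm (y :: 'h :: complex_hilbert)"
  using cmod_cinner_le[of x y] complex_Re_le_cmod[of "cinner x y"] by linarith

lemma Re_cinner_self: "Re (cinner x x) = (norm (x :: 'h :: complex_hilbert))\<^sup>2"
  by (simp add: cinner_self)

lemma cinner_eqI:
  fixes x y :: "'h :: complex_hilbert"
  assumes "\<And>z. cinner z x = cinner z y"
  shows "x = y"
proof -
  have "cinner (x - y) (x - y) = 0"
    using assms[of "x - y"] by (simp add: cinner.diff_right)
  then show ?thesis
    by (simp add: cinner_self)
qed

lemma power2_norm_diff:
  "(norm (x - y))\<^sup>2 = (norm x)\<^sup>2 - 2 * Re (cinner x y) + (norm (y :: 'h :: complex_hilbert))\<^sup>2"
  using power2_norm_add[of x "- y"] by (simp add: cinner.minus_right)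

section \<open>The Riesz representation theorem\<close>

text \<open>The representing vector minimises \<open>\<parallel>x\<parallel>\<^sup>2 - 2 f x\<close> on the subspace. By the parallelogram law
  minimising sequences are Cauchy, so completeness provides a minimiser, and the vanishing of the
  first variation there is the representation of \<open>f\<close>.\<close>

lemma riesz_real:
  fixes K :: "'h :: complex_hilbert set"
  assumes K: "subspace K" "closed K" and f: "bounded_linear (f :: 'h \<Rightarrow> real)"
  obtains u where "u \<in> K" and "\<And>x. x \<in> K \<Longrightarrow> f x = Re (cinner x u)"
proof -
  interpret f: bounded_linear f by (rule f)
  obtain C where C: "\<And>x. norm (f x) \<le> norm x * C"
    using f.bounded by blast
  define J where "J x = (norm x)\<^sup>2 - 2 * f x" for x
  have J_ge: "J x \<ge> - C\<^sup>2" for x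
  proof -
    have "0 \<le> (norm x - C)\<^sup>2"
      by simp
    moreover have "f x \<le> norm x * C"
      using C[of x] by simp
    ultimately show ?thesis
      unfolding J_def by (simp add: power2_diff)
  qed
  define m where "m = Inf (J ` K)"
  have bdd: "bdd_below (J ` K)"
    using J_ge by (auto simp: bdd_below_def)
  have m_le: "m \<le> J x" if "x \<in> K" for x
    unfolding m_def using that bdd by (simp add: cInf_lower)
  have "\<exists>x\<in>K. J x < m + 1 / real (Suc n)" for n
  proof -
    have "J ` K \<noteq> {}"
      using subspace_0[OF K(1)] by auto
    moreover have "Inf (J ` K) < m + 1 / real (Suc n)"
      unfolding m_def by simp
    ultimately show ?thesis
      using bdd by (subst (asm) cInf_less_iff) auto
  qed
  then obtain X where XK: "\<And>n. X n \<in> K" and XJ: "\<And>n. J (X n) < m + 1 / real (Suc n)"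
    by metis
  have para: "(norm (x - y))\<^sup>2 \<le> 2 * (J x + J y - 2 * m)" if "x \<in> K" "y \<in> K" for x y
  proof -
    have "m \<le> J ((1/2) *\<^sub>R (x + y))"
      using that K(1) by (intro m_le subspace_scale subspace_add)
    also have "\<dots> = (norm (x + y))\<^sup>2 / 4 - f x - f y"
      unfolding J_def by (simp add: f.scaleR f.add power_divide add_divide_distrib)
    finally show ?thesis
      unfolding J_def power2_norm_add power2_norm_diff by argo
  qed
  have "Cauchy X"
  proof (rule metric_CauchyI)
    fix e :: real assume "e > 0"
    then obtain N where N: "inverse (real (Suc N)) < e\<^sup>2 / 4"
      using reals_Archimedean[of "e\<^sup>2 / 4"] by auto
    have "dist (X i) (X j) < e" if "i \<ge> N" "j \<ge> N" for i j
    proof -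
      have "1 / real (Suc i) \<le> 1 / real (Suc N)" "1 / real (Suc j) \<le> 1 / real (Suc N)"
        using that by (auto intro!: divide_left_mono)
      then have "(norm (X i - X j))\<^sup>2 < e\<^sup>2"
        using para[OF XK XK, of i j] XJ[of i] XJ[of j] N by (simp add: inverse_eq_divide)
      then show ?thesis
        using \<open>e > 0\<close> by (simp add: dist_norm power2_less_imp_less)
    qed
    then show "\<exists>N. \<forall>i\<ge>N. \<forall>j\<ge>N. dist (X i) (X j) < e"
      by blast
  qed
  then obtain u where u: "X \<longlonglongrightarrow> u"
    using Cauchy_convergent_iff convergent_def by blast
  have uK: "u \<in> K"
    using K(2) XK u closed_sequentially by blast
  have "(\<lambda>n. J (X n)) \<longlonglongrightarrow> J u"
    unfolding J_def by (intro tendsto_intros u f.tendsto)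
  moreover have "(\<lambda>n. m + 1 / real (Suc n)) \<longlonglongrightarrow> m + 0"
    by (intro tendsto_intros LIMSEQ_Suc lim_1_over_n)
  ultimately have "J u \<le> m + 0"
    using XJ by (intro LIMSEQ_le[of "\<lambda>n. J (X n)"]) (auto intro: less_imp_le)
  then have min: "J u \<le> J (u + t *\<^sub>R x)" if "x \<in> K" for x t
    using m_le[of "u + t *\<^sub>R x"] that uK K(1) by (simp add: subspace_add subspace_scale)
  have "f x = Re (cinner x u)" if "x \<in> K" for x
  proof -
    define g where "g t = 2 * t * (Re (cinner x u) - f x) + t\<^sup>2 * (norm x)\<^sup>2" for t
    have "Re (cinner u x) = Re (cinner x u)"
      using cinner_commute[of u x] by simp
    then have "g t \<ge> 0" for t
      using min[OF that, of t] unfolding J_def power2_norm_add g_def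
      by (simp add: f.add f.scaleR cinner.scaleR_right algebra_simps power_mult_distrib)
    then have "g 0 \<le> g t" for t
      by (simp add: g_def)
    moreover have "(g has_real_derivative 2 * (Re (cinner x u) - f x)) (at 0)"
      unfolding g_def by (auto intro!: derivative_eq_intros)
    ultimately have "2 * (Re (cinner x u) - f x) = 0"
      by (intro DERIV_local_min[of g _ 0 1]) auto
    then show ?thesis
      by simp
  qed
  with uK that show ?thesis
    by blast
qed

lemma riesz:
  fixes K :: "'h :: complex_hilbert set"
  assumes K: "subspace K" "closed K" "\<And>c x. x \<in> K \<Longrightarrow> c *\<^sub>C x \<in> K"
    and f: "bounded_linear f" "\<And>c x. f (c *\<^sub>C x) = c * f x"
  obtains u where "u \<in> K" and "\<And>x. x \<in> K \<Longrightarrow> f x = cinner x u"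
proof -
  have "bounded_linear (\<lambda>x. Re (f x))"
    by (rule bounded_linear_compose[OF bounded_linear_Re f(1)])
  from riesz_real[OF K(1,2) this]
  obtain u where u: "u \<in> K" and eq: "\<And>x. x \<in> K \<Longrightarrow> Re (f x) = Re (cinner x u)"
    by blast
  have "f x = cinner x u" if "x \<in> K" for x
    \<comment> \<open>the imaginary parts agree because the real parts agree at \<open>\<i> x\<close>\<close>
    using eq[OF that] eq[OF K(3)[OF that, of \<i>]] by (simp add: f(2) cinner_scaleC_left complex_eq_iff)
  with u that show ?thesis
    by blast
qed

section \<open>Adjoints\<close>

lemma bounded_operatorsD: "T \<in> bounded_operators \<Longrightarrow> T (c *\<^sub>C x) = c *\<^sub>C T x"
  by (simp add: bounded_operators_def)

lemma cadjoint_eqI: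
  fixes T S :: "'h :: complex_hilbert \<Rightarrow>\<^sub>L 'h"
  assumes "\<And>x y. cinner (T x) y = cinner x (S y)"
  shows "cadjoint T = S"
  unfolding cadjoint_def
proof (rule the_equality)
  show "\<forall>x y. cinner (T x) y = cinner x (S y)"
    using assms by blast
  show "R = S" if "\<forall>x y. cinner (T x) y = cinner x (R y)" for R :: "'h \<Rightarrow>\<^sub>L 'h"
    by (rule blinfun_eqI, rule cinner_eqI) (simp add: that[rule_format, symmetric] assms[symmetric])
qed

lemma cinner_cadjoint:
  fixes T :: "'h :: complex_hilbert \<Rightarrow>\<^sub>L 'h"
  assumes T: "T \<in> bounded_operators"
  shows "cinner (T x) y = cinner x (cadjoint T y)"
proof -
  have "\<exists>u. \<forall>x. cinner (T x) y = cinner x u" for y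
  proof -
    have "bounded_linear (\<lambda>x. cinner (T x) y)"
      by (rule bounded_linear_compose[OF cinner.bounded_linear_left blinfun.bounded_linear_right])
    moreover have "cinner (T (c *\<^sub>C x)) y = c * cinner (T x) y" for c x
      using T by (simp add: bounded_operatorsD cinner_scaleC_left)
    ultimately obtain u where "\<And>x. x \<in> UNIV \<Longrightarrow> cinner (T x) y = cinner x u"
      by (rule riesz[OF subspace_UNIV closed_UNIV UNIV_I]) blast+
    then show ?thesis
      by blast
  qed
  then obtain S where S: "\<And>x y. cinner (T x) y = cinner x (S y)"
    by metis
  have "bounded_linear S"
  proof (rule bounded_linear_intro[where K = "norm T"])
    show "S (y + z) = S y + S z" for y z
      by (rule cinner_eqI) (simp add: cinner_add_right S[symmetric])
    show "S (r *\<^sub>R y) = r *\<^sub>R S y" for r y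
      by (rule cinner_eqI) (simp add: cinner.scaleR_right S[symmetric])
    show "norm (S y) \<le> norm y * norm T" for y
    proof (cases "S y = 0")
      case False
      have "(norm (S y))\<^sup>2 = Re (cinner (T (S y)) y)"
        by (simp add: S cinner_self)
      also have "\<dots> \<le> norm (T (S y)) * norm y"
        by (rule Re_cinner_le)
      also have "\<dots> \<le> norm T * norm (S y) * norm y"
        by (intro mult_right_mono norm_blinfun norm_ge_zero)
      finally show ?thesis
        using False by (simp add: power2_eq_square mult_ac)
    qed simp
  qed
  then have "cadjoint T = Blinfun S"
    by (intro cadjoint_eqI) (simp add: S bounded_linear_Blinfun_apply)
  with \<open>bounded_linear S\<close> show ?thesis
    by (simp add: S bounded_linear_Blinfun_apply)
qed

lemma cinner_cadjoint_left:
  fixes T :: "'h :: complex_hilbert \<Rightarrow>\<^sub>L 'h"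
  assumes "T \<in> bounded_operators"
  shows "cinner (cadjoint T x) y = cinner x (T y)"
  using cinner_cadjoint[OF assms, of y x] by (metis cinner_commute)

lemma scaleC_op_apply [simp]: "scaleC_op c T x = c *\<^sub>C T x"
  by (simp add: scaleC_op.rep_eq)

lemma scaleC_op_of_real: "scaleC_op (complex_of_real r) T = r *\<^sub>R T"
  by (rule blinfun_eqI) (simp add: scaleC_of_real blinfun.scaleR_left)

section \<open>Closedness and inverses in a von Neumann algebra\<close>

text \<open>The sets \<open>U\<close> with this property contain the subbasis of the weak operator topology and are
  stable under finite intersections and unions.\<close>

lemma tendsto_open_weak_operator:
  fixes T :: "'h :: complex_hilbert \<Rightarrow>\<^sub>L 'h"
  assumes "openin weak_operator_topology U" and "T \<in> U"
    and bounded: "\<And>i. S i \<in> bounded_operators"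
    and lim: "\<And>x y. ((\<lambda>i. cinner (S i x) y) \<longlongrightarrow> cinner (T x) y) F"
  shows "eventually (\<lambda>i. S i \<in> U) F"
proof -
  have "generate_topology_on {{T \<in> bounded_operators. cinner (T x) y \<in> W} | x y W. open W} U"
    using assms(1) unfolding weak_operator_topology_def by (simp add: openin_topology_generated_by_iff)
  then show ?thesis
    using \<open>T \<in> U\<close>
  proof (induction rule: generate_topology_on.induct)
    case (Int a b)
    then show ?case
      by (simp add: eventually_conj_iff)
  next
    case (UN \<U>)
    then obtain k where k: "k \<in> \<U>" "T \<in> k"
      by blast
    then have "eventually (\<lambda>i. S i \<in> k) F"
      using UN.IH by blast
    then show ?case
      using k(1) by (auto elim: eventually_mono)
  next
    case (Basis s)
    then obtain x y W where s: "s = {T \<in> bounded_operators. cinner (T x) y \<in> W}" and "open W"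
      by blast
    with Basis.prems have "eventually (\<lambda>i. cinner (S i x) y \<in> W) F"
      using topological_tendstoD[OF lim] by blast
    then show ?case
      by (simp add: s bounded)
  qed simp
qed

locale vn_algebra =
  fixes M :: "('h :: complex_hilbert \<Rightarrow>\<^sub>L 'h) set"
  assumes vn: "von_neumann_algebra M"
begin

lemma bounded: "T \<in> M \<Longrightarrow> T \<in> bounded_operators"
  and one_mem: "id_blinfun \<in> M"
  and add_mem: "S \<in> M \<Longrightarrow> T \<in> M \<Longrightarrow> S + T \<in> M"
  and scaleC_mem: "T \<in> M \<Longrightarrow> scaleC_op c T \<in> M"
  and compose_mem: "S \<in> M \<Longrightarrow> T \<in> M \<Longrightarrow> S o\<^sub>L T \<in> M"
  and cadjoint_mem: "T \<in> M \<Longrightarrow> cadjoint T \<in> M"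
  and closedin_weak: "closedin weak_operator_topology M"
  using vn unfolding von_neumann_algebra_def by blast+

lemma apply_scaleC: "T \<in> M \<Longrightarrow> T (c *\<^sub>C x) = c *\<^sub>C T x"
  by (simp add: bounded bounded_operatorsD)

lemma scaleR_mem: "T \<in> M \<Longrightarrow> r *\<^sub>R T \<in> M"
  by (metis scaleC_mem scaleC_op_of_real)

lemma diff_mem: "S \<in> M \<Longrightarrow> T \<in> M \<Longrightarrow> S - T \<in> M"
  using add_mem[of S "(- 1) *\<^sub>R T"] scaleR_mem[of T "- 1"] by simp

lemma sum_mem: "(\<And>i. i \<in> I \<Longrightarrow> S i \<in> M) \<Longrightarrow> (\<Sum>i\<in>I. S i) \<in> M"
proof (induction I rule: infinite_finite_induct)
  case (insert i I)
  then show ?case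
    by (simp add: add_mem)
qed (use scaleR_mem[OF one_mem, of 0] in simp_all)

lemma weak_limit_mem:
  assumes "F \<noteq> bot" and S: "\<And>i. S i \<in> M" and T: "T \<in> bounded_operators"
    and lim: "\<And>x y. ((\<lambda>i. cinner (S i x) y) \<longlongrightarrow> cinner (T x) y) F"
  shows "T \<in> M"
proof (rule ccontr)
  assume "T \<notin> M"
  have "topspace weak_operator_topology = (bounded_operators :: ('h \<Rightarrow>\<^sub>L 'h) set)"
    unfolding weak_operator_topology_def topology_generated_by_topspace
    by (auto intro!: exI[of _ UNIV])
  with \<open>T \<notin> M\<close> T have "openin weak_operator_topology (bounded_operators - M)"
    and "T \<in> bounded_operators - M"
    using closedin_weak unfolding closedin_def by auto
  then have "eventually (\<lambda>i. S i \<in> bounded_operators - M) F"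
    using lim by (intro tendsto_open_weak_operator) (simp_all add: bounded S)
  with S have "eventually (\<lambda>_. False) F"
    by simp
  with \<open>F \<noteq> bot\<close> show False
    by (simp add: eventually_False)
qed

lemma closed: "closed M"
  unfolding closed_sequential_limits
proof safe
  fix S T assume S: "\<forall>n. S n \<in> M" and lim: "S \<longlonglongrightarrow> T"
  have lim_apply: "(\<lambda>n. S n x) \<longlonglongrightarrow> T x" for x
    by (intro blinfun.tendsto lim tendsto_const)
  have "T (c *\<^sub>C x) = c *\<^sub>C T x" for c x
  proof -
    have "bounded_linear (\<lambda>x :: 'h. c *\<^sub>C x)"
      using blinfun.bounded_linear_right[of "scaleC_op c (id_blinfun :: 'h \<Rightarrow>\<^sub>L 'h)"] by simp
    then have "(\<lambda>n. c *\<^sub>C S n x) \<longlonglongrightarrow> c *\<^sub>C T x"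
      by (rule bounded_linear.tendsto) (rule lim_apply)
    then have "(\<lambda>n. S n (c *\<^sub>C x)) \<longlonglongrightarrow> c *\<^sub>C T x"
      using S by (simp add: apply_scaleC)
    then show ?thesis
      using lim_apply LIMSEQ_unique by blast
  qed
  then have "T \<in> bounded_operators"
    by (simp add: bounded_operators_def)
  moreover have "(\<lambda>n. cinner (S n x) y) \<longlonglongrightarrow> cinner (T x) y" for x y
    by (rule cinner.tendsto[OF lim_apply tendsto_const])
  ultimately show "T \<in> M"
    using S by (auto intro: weak_limit_mem[of sequentially S])
qed

text \<open>For small \<open>s > 0\<close> the operator \<open>I - s T\<close> has norm less than 1, so that \<open>Y \<mapsto> Y + s (I - T Y)\<close>
  is a contraction of the complete set \<open>M\<close>; its fixed point is a right inverse of \<open>T\<close>. It is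
  also a left inverse since coercivity makes \<open>T\<close> injective. Constructing the inverse as a limit
  inside \<open>M\<close> avoids the bicommutant theorem.\<close>

lemma coercive_invertible:
  assumes T: "T \<in> M" and "e > 0" and coercive: "\<And>x. e * (norm x)\<^sup>2 \<le> Re (cinner (T x) x)"
  obtains R where "R \<in> M" and "T o\<^sub>L R = id_blinfun" and "R o\<^sub>L T = id_blinfun"
    and "\<And>x. e * norm (R x) \<le> norm x"
proof -
  define N where "N = norm T + e"
  have N: "N > 0" "e \<le> N" "norm T \<le> N"
    using \<open>e > 0\<close> by (auto simp: N_def intro: add_nonneg_pos)
  \<comment> \<open>\<open>\<parallel>x - s T x\<parallel>\<^sup>2 \<le> (1 - 2 s e + s\<^sup>2 N\<^sup>2) \<parallel>x\<parallel>\<^sup>2\<close>, and the factor is smallest at this \<open>s\<close>\<close>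
  define s where "s = e / N\<^sup>2"
  define q where "q = sqrt (1 - e\<^sup>2 / N\<^sup>2)"
  have "s > 0"
    using N \<open>e > 0\<close> by (simp add: s_def)
  have "e\<^sup>2 / N\<^sup>2 \<le> 1" "e\<^sup>2 / N\<^sup>2 > 0"
    using N \<open>e > 0\<close> by (simp_all add: power_mono)
  then have q: "0 \<le> q" "q < 1" "q\<^sup>2 = 1 - e\<^sup>2 / N\<^sup>2"
    by (simp_all add: q_def)
  have contr: "norm (x - s *\<^sub>R T x) \<le> q * norm x" for x
  proof (rule power2_le_imp_le)
    have "norm (T x) \<le> N * norm x"
      using norm_blinfun[of T x] N(3) mult_right_mono[OF N(3), of "norm x"] by simp
    then have "s\<^sup>2 * (norm (T x))\<^sup>2 \<le> s\<^sup>2 * (N * norm x)\<^sup>2"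
      by (intro mult_left_mono power_mono) simp_all
    moreover have "s * (e * (norm x)\<^sup>2) \<le> s * Re (cinner (T x) x)"
      using coercive \<open>s > 0\<close> by simp
    moreover have "Re (cinner x (T x)) = Re (cinner (T x) x)"
      using cinner_commute[of x "T x"] by simp
    ultimately have "(norm (x - s *\<^sub>R T x))\<^sup>2
        \<le> (norm x)\<^sup>2 - 2 * (s * (e * (norm x)\<^sup>2)) + s\<^sup>2 * (N * norm x)\<^sup>2"
      unfolding power2_norm_diff by (simp add: cinner.scaleR_right power_mult_distrib)
    also have "\<dots> = (q * norm x)\<^sup>2"
      unfolding power_mult_distrib q(3) using N(1) by (simp add: s_def field_simps power2_eq_square)
    finally show "(norm (x - s *\<^sub>R T x))\<^sup>2 \<le> (q * norm x)\<^sup>2" .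
  qed (simp add: q)
  define f where "f Y = Y + s *\<^sub>R (id_blinfun - (T o\<^sub>L Y))" for Y
  have "\<exists>!Y\<in>M. f Y = Y"
  proof (rule Banach_fix)
    show "complete M"
      using closed by (simp add: complete_eq_closed)
    show "M \<noteq> {}"
      using one_mem by blast
    show "0 \<le> q" "q < 1"
      by (fact q)+
    show "f ` M \<subseteq> M"
      by (auto simp: f_def T intro!: add_mem scaleR_mem diff_mem one_mem compose_mem)
    show "dist (f Y) (f Z) \<le> q * dist Y Z" for Y Z
      unfolding dist_norm
    proof (rule norm_blinfun_bound)
      show "0 \<le> q * norm (Y - Z)"
        by (simp add: q)
      fix x
      have "norm ((f Y - f Z) x) = norm ((Y - Z) x - s *\<^sub>R T ((Y - Z) x))"
        by (simp add: f_def blinfun.bilinear_simps algebra_simps)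
      also have "\<dots> \<le> q * norm ((Y - Z) x)"
        by (rule contr)
      also have "\<dots> \<le> q * (norm (Y - Z) * norm x)"
        by (intro mult_left_mono norm_blinfun q)
      finally show "norm ((f Y - f Z) x) \<le> q * norm (Y - Z) * norm x"
        by (simp add: mult.assoc)
    qed
  qed
  then obtain R where R: "R \<in> M" and "f R = R"
    by blast
  then have TR: "T o\<^sub>L R = id_blinfun"
    using \<open>s > 0\<close> by (simp add: f_def)
  then have TR_apply: "T (R x) = x" for x
    by (metis blinfun_apply_blinfun_compose blinfun_apply_id_blinfun id_apply)
  have RT: "R o\<^sub>L T = id_blinfun"
  proof (rule blinfun_eqI)
    fix x
    have "T (R (T x) - x) = 0"
      by (simp add: blinfun.diff_right TR_apply)
    then have "e * (norm (R (T x) - x))\<^sup>2 \<le> 0"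
      using coercive[of "R (T x) - x"] by (simp add: cinner.zero_left)
    then show "(R o\<^sub>L T) x = id_blinfun x"
      using \<open>e > 0\<close> by (simp add: mult_le_0_iff)
  qed
  have "e * norm (R x) \<le> norm x" for x
  proof (cases "R x = 0")
    case False
    have "e * (norm (R x))\<^sup>2 \<le> norm x * norm (R x)"
      using coercive[of "R x"] Re_cinner_le[of x "R x"] by (simp add: TR_apply)
    with False show ?thesis
      by (simp add: power2_eq_square mult.assoc[symmetric])
  qed simp
  with R TR RT that show ?thesis
    by blast
qed

end

section \<open>Orthogonal projections\<close>

lemma subspace_closure:
  fixes S :: "'a :: real_normed_vector set"
  assumes "subspace S"
  shows "subspace (closure S)"
  unfolding subspace_def
proof (intro conjI allI ballI)
  show "0 \<in> closure S"
    using subspace_0[OF assms] closure_subset by blast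
  fix x y :: 'a and r :: real assume "x \<in> closure S" "y \<in> closure S"
  then obtain X Y where "\<And>n. X n \<in> S" "X \<longlonglongrightarrow> x" "\<And>n. Y n \<in> S" "Y \<longlonglongrightarrow> y"
    unfolding closure_sequential by blast
  then show "x + y \<in> closure S"
    unfolding closure_sequential
    by (intro exI[of _ "\<lambda>n. X n + Y n"] conjI tendsto_add) (simp_all add: subspace_add[OF assms])
next
  fix x :: 'a and r :: real assume "x \<in> closure S"
  then obtain X where "\<And>n. X n \<in> S" "X \<longlonglongrightarrow> x"
    unfolding closure_sequential by blast
  then show "r *\<^sub>R x \<in> closure S"
    unfolding closure_sequential
    by (intro exI[of _ "\<lambda>n. r *\<^sub>R X n"] conjI tendsto_intros) (simp_all add: subspace_scale[OF assms])
qed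

lemma closure_span_minimal: "G \<subseteq> V \<Longrightarrow> subspace V \<Longrightarrow> closed V \<Longrightarrow> closure (span G) \<subseteq> V"
  by (simp add: closure_minimal span_minimal)

lemma closure_span_invariant:
  assumes f: "bounded_linear f" and G: "\<And>g. g \<in> G \<Longrightarrow> f g \<in> closure (span G)"
    and "x \<in> closure (span G)"
  shows "f x \<in> closure (span G)"
proof -
  interpret f: bounded_linear f by (rule f)
  let ?V = "f -` closure (span G)"
  have "subspace ?V"
    by (rule linear_subspace_vimage) (simp_all add: f.linear_axioms subspace_closure)
  moreover have "closed ?V"
    by (rule continuous_closed_vimage) (simp_all add: f.isCont)
  ultimately have "closure (span G) \<subseteq> ?V"
    using G by (intro closure_span_minimal) auto
  with assms(3) show ?thesis
    by blast
qed

lemma bounded_linear_scaleC: "bounded_linear (\<lambda>x :: 'h :: complex_hilbert. c *\<^sub>C x)"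
  using blinfun.bounded_linear_right[of "scaleC_op c (id_blinfun :: 'h \<Rightarrow>\<^sub>L 'h)"] by simp

lemma orthogonal_unique:
  fixes K :: "'h :: complex_hilbert set"
  assumes K: "subspace K" and "p \<in> K" "q \<in> K" and eq: "\<And>k. k \<in> K \<Longrightarrow> cinner k p = cinner k q"
  shows "p = q"
proof -
  have "cinner (p - q) (p - q) = 0"
    using eq[OF subspace_diff[OF assms(1-3)]] by (simp add: cinner.diff_right)
  then show ?thesis
    by (simp add: cinner_self)
qed

text \<open>The projection of \<open>v\<close> is the vector of \<open>K\<close> that represents the functional \<open>\<langle>\<cdot>, v\<rangle>\<close> on \<open>K\<close>.\<close>

lemma orthogonal_projection_exists:
  fixes K :: "'h :: complex_hilbert set"
  assumes K: "subspace K" "closed K" "\<And>c x. x \<in> K \<Longrightarrow> c *\<^sub>C x \<in> K"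
  obtains e where "e \<in> bounded_operators" and "\<And>v. e v \<in> K"
    and "\<And>k v. k \<in> K \<Longrightarrow> cinner k (e v) = cinner k v"
proof -
  have "\<exists>u\<in>K. \<forall>k\<in>K. cinner k u = cinner k v" for v
  proof (rule riesz[OF K cinner.bounded_linear_left[of v]])
    show "cinner (c *\<^sub>C x) v = c * cinner x v" for c x
      by (rule cinner_scaleC_left)
  qed metis+
  then obtain E where EK: "\<And>v. E v \<in> K" and E: "\<And>k v. k \<in> K \<Longrightarrow> cinner k (E v) = cinner k v"
    by metis
  have scaleC: "E (c *\<^sub>C v) = c *\<^sub>C E v" for c v
    by (rule orthogonal_unique[OF K(1)]) (simp_all add: EK E K cinner_scaleC_right)
  have "bounded_linear E"
  proof (rule bounded_linear_intro[where K = 1])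
    show "E (v + w) = E v + E w" for v w
      by (rule orthogonal_unique[OF K(1)]) (simp_all add: EK E K subspace_add cinner_add_right)
    show "E (r *\<^sub>R v) = r *\<^sub>R E v" for r v
      using scaleC[of "complex_of_real r" v] by (simp add: scaleC_of_real)
    show "norm (E v) \<le> norm v * 1" for v
    proof (cases "E v = 0")
      case False
      have "(norm (E v))\<^sup>2 = Re (cinner (E v) v)"
        using arg_cong[OF E[OF EK[of v], of v], of Re] by (simp add: Re_cinner_self)
      with Re_cinner_le[of "E v" v] have "norm (E v) * norm (E v) \<le> norm (E v) * norm v"
        by (simp add: power2_eq_square)
      with False show ?thesis
        by simp
    qed simp
  qed
  then have "blinfun_apply (Blinfun E) = E"
    by (rule bounded_linear_Blinfun_apply)
  with that[of "Blinfun E"] EK E scaleC show ?thesis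
    by (simp add: bounded_operators_def)
qed

section \<open>Range projections and primeness\<close>

context vn_algebra
begin

text \<open>With \<open>h = (\<Sum>x\<in>F. x x\<^sup>*)\<close> the approximate unit is \<open>S = h (h + e)\<^sup>-\<^sup>1\<close>, so that
  \<open>I - S = e (h + e)\<^sup>-\<^sup>1\<close>. For \<open>z = (h + e)\<^sup>-\<^sup>1 (x w)\<close> and \<open>s = \<parallel>x\<^sup>* z\<parallel>\<close> one has
  \<open>s\<^sup>2 + e \<parallel>z\<parallel>\<^sup>2 \<le> Re \<langle>(h + e) z, z\<rangle> = Re \<langle>w, x\<^sup>* z\<rangle> \<le> s \<parallel>w\<parallel>\<close>, which bounds \<open>(I - S) (x w) = e z\<close>.\<close>

lemma approximate_unit:
  assumes F: "finite F" "F \<subseteq> M" and "e > 0"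
  obtains S where "S \<in> M" and "\<And>v. norm (v - S v) \<le> norm v"
    and "\<And>u. (\<And>x. x \<in> F \<Longrightarrow> cadjoint x u = 0) \<Longrightarrow> S u = 0"
    and "\<And>x w. x \<in> F \<Longrightarrow> (norm (x w - S (x w)))\<^sup>2 \<le> e * (norm w)\<^sup>2"
proof -
  define h where "h = (\<Sum>x\<in>F. x o\<^sub>L cadjoint x)"
  have hM: "h \<in> M"
    unfolding h_def using F by (intro sum_mem compose_mem cadjoint_mem) blast+
  have h_apply: "h v = (\<Sum>x\<in>F. x (cadjoint x v))" for v
    by (simp add: h_def blinfun.sum_left)
  have h_form: "Re (cinner (h v) v) = (\<Sum>x\<in>F. (norm (cadjoint x v))\<^sup>2)" for v
  proof -
    have "cinner (h v) v = (\<Sum>x\<in>F. cinner (cadjoint x v) (cadjoint x v))"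
      unfolding h_apply cinner.sum_left using F
      by (intro sum.cong refl cinner_cadjoint bounded) blast
    then show ?thesis
      by (simp add: Re_cinner_self)
  qed
  define T where "T = h + e *\<^sub>R id_blinfun"
  have TM: "T \<in> M"
    unfolding T_def by (intro add_mem scaleR_mem hM one_mem)
  have T_apply: "T v = h v + e *\<^sub>R v" for v
    by (simp add: T_def blinfun.add_left blinfun.scaleR_left)
  have T_form: "Re (cinner (T v) v) = (\<Sum>x\<in>F. (norm (cadjoint x v))\<^sup>2) + e * (norm v)\<^sup>2" for v
    by (simp add: T_apply cinner.add_left cinner.scaleR_left h_form Re_cinner_self)
  then have "e * (norm v)\<^sup>2 \<le> Re (cinner (T v) v)" for v
    by (simp add: sum_nonneg)
  then obtain R where RM: "R \<in> M" and TR: "T o\<^sub>L R = id_blinfun" and RT: "R o\<^sub>L T = id_blinfun"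
    and R_bound: "\<And>v. e * norm (R v) \<le> norm v"
    using coercive_invertible[OF TM \<open>e > 0\<close>] by metis
  have TR_apply: "T (R v) = v" and RT_apply: "R (T v) = v" for v
    using arg_cong[OF TR, of "\<lambda>Y. Y v"] arg_cong[OF RT, of "\<lambda>Y. Y v"] by simp_all
  define S where "S = h o\<^sub>L R"
  have S_compl: "v - S v = e *\<^sub>R R v" for v
    using TR_apply[of v] by (simp add: S_def T_apply algebra_simps)
  show ?thesis
  proof
    show "S \<in> M"
      unfolding S_def by (intro compose_mem hM RM)
    show "norm (v - S v) \<le> norm v" for v
      unfolding S_compl using R_bound \<open>e > 0\<close> by simp
    show "S u = 0" if "\<And>x. x \<in> F \<Longrightarrow> cadjoint x u = 0" for u
    proof -
      have "T u = e *\<^sub>R u"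
        using that by (simp add: T_apply h_apply)
      then have "e *\<^sub>R R u = u"
        by (metis RT_apply blinfun.scaleR_right)
      then show ?thesis
        using S_compl[of u] by simp
    qed
    show "(norm (x w - S (x w)))\<^sup>2 \<le> e * (norm w)\<^sup>2" if x: "x \<in> F" for x w
    proof -
      define z where "z = R (x w)"
      define s where "s = norm (cadjoint x z)"
      have "s\<^sup>2 \<le> (\<Sum>x\<in>F. (norm (cadjoint x z))\<^sup>2)"
        unfolding s_def using F x by (intro member_le_sum) auto
      then have "s\<^sup>2 + e * (norm z)\<^sup>2 \<le> Re (cinner (T z) z)"
        by (simp add: T_form)
      also have "cinner (T z) z = cinner w (cadjoint x z)"
        unfolding z_def TR_apply using F x by (intro cinner_cadjoint bounded) blast
      also have "Re \<dots> \<le> norm w * s"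
        unfolding s_def by (rule Re_cinner_le)
      also have "\<dots> \<le> (norm w)\<^sup>2 + s\<^sup>2"
      proof -
        have "0 \<le> norm w * s"
          by (simp add: s_def)
        then show ?thesis
          using sum_squares_bound[of "norm w" s] by linarith
      qed
      finally have "e * (e * (norm z)\<^sup>2) \<le> e * (norm w)\<^sup>2"
        using \<open>e > 0\<close> by simp
      then show ?thesis
        unfolding S_compl z_def[symmetric] by (simp add: power_mult_distrib power2_eq_square mult_ac)
    qed
  qed
qed

text \<open>The projection onto the closed span of the ranges of the operators in \<open>I\<close> is the strong limit
  of the approximate units of the finite subsets of \<open>I\<close>: they tend to the identity on every vector
  \<open>x w\<close>, hence on the closed span because \<open>I - S\<close> is contractive, and they vanish on the orthogonal
  complement.\<close>

lemma range_projection_mem: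
  assumes I: "I \<subseteq> M" and K: "K = closure (span (\<Union>x\<in>I. range (blinfun_apply x)))"
  obtains e where "e \<in> M" and "\<And>v. e v \<in> K" and "\<And>k v. k \<in> K \<Longrightarrow> cinner k (e v) = cinner k v"
proof -
  let ?G = "(\<Union>x\<in>I. range (blinfun_apply x))"
  have subK: "subspace K"
    unfolding K by (intro subspace_closure subspace_span)
  have GK: "g \<in> K" if "g \<in> ?G" for g
    unfolding K by (rule subsetD[OF order.trans[OF span_superset closure_subset] that])
  have "c *\<^sub>C k \<in> K" if "k \<in> K" for c k
    unfolding K
  proof (rule closure_span_invariant[OF bounded_linear_scaleC])
    fix g assume "g \<in> ?G"
    then obtain x w where "x \<in> I" "g = x w"
      by blast
    with I have "c *\<^sub>C g = x (c *\<^sub>C w)"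
      by (auto simp: apply_scaleC)
    with \<open>x \<in> I\<close> show "c *\<^sub>C g \<in> closure (span ?G)"
      using GK K by blast
  qed (use that K in blast)
  then obtain e where e: "e \<in> bounded_operators" "\<And>v. e v \<in> K"
      "\<And>k v. k \<in> K \<Longrightarrow> cinner k (e v) = cinner k v"
    using orthogonal_projection_exists[OF subK] K by blast
  define good where "good F n S \<longleftrightarrow> (\<forall>v. norm (v - S v) \<le> norm v)
      \<and> (\<forall>u. (\<forall>x\<in>F. cadjoint x u = 0) \<longrightarrow> S u = 0)
      \<and> (\<forall>x\<in>F. \<forall>w. (norm (x w - S (x w)))\<^sup>2 \<le> 1 / real (Suc n) * (norm w)\<^sup>2)"
    for F n and S :: "'h \<Rightarrow>\<^sub>L 'h"
  have "\<exists>S. S \<in> M \<and> (finite F \<and> F \<subseteq> I \<longrightarrow> good F n S)" for F n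
    \<comment> \<open>for other \<open>F\<close> the identity serves as a default value\<close>
  proof (cases "finite F \<and> F \<subseteq> I")
    case True
    then have "finite F" "F \<subseteq> M"
      using I by blast+
    then show ?thesis
      unfolding good_def by (rule approximate_unit[of F "1 / real (Suc n)"]) (simp, blast)
  qed (use one_mem in blast)
  then have "\<exists>S. \<forall>i. S i \<in> M \<and> (finite (fst i) \<and> fst i \<subseteq> I \<longrightarrow> good (fst i) (snd i) (S i))"
    by (intro choice) simp
  then obtain S where SM: "\<And>i. S i \<in> M"
    and good: "\<And>i. finite (fst i) \<Longrightarrow> fst i \<subseteq> I \<Longrightarrow> good (fst i) (snd i) (S i)"
    by blast
  \<comment> \<open>the finite subset grows to \<open>I\<close> while the parameter \<open>1 / (n + 1)\<close> of its approximate unit tends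
    to 0\<close>
  define \<Phi> where "\<Phi> = (finite_subsets_at_top I \<times>\<^sub>F sequentially)"
  have fst_lim: "filterlim fst (finite_subsets_at_top I) \<Phi>" and snd_lim: "filterlim snd sequentially \<Phi>"
    unfolding \<Phi>_def by (rule filterlim_fst filterlim_snd)+
  have ev_good: "eventually (\<lambda>i. fst i \<subseteq> I \<and> good (fst i) (snd i) (S i)) \<Phi>"
  proof -
    have "eventually (\<lambda>i. finite (fst i) \<and> fst i \<subseteq> I) \<Phi>"
      by (rule eventually_compose_filterlim[OF _ fst_lim])
        (simp add: eventually_finite_subsets_at_top_weakI)
    then show ?thesis
      by eventually_elim (simp add: good)
  qed
  define V where "V = {v. ((\<lambda>i. S i v) \<longlongrightarrow> v) \<Phi>}"
  have "K \<subseteq> V"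
    unfolding K
  proof (rule closure_span_minimal)
    show "subspace V"
      unfolding subspace_def V_def
      by (auto simp: blinfun.bilinear_simps intro!: tendsto_add tendsto_scaleR)
    show "?G \<subseteq> V"
    proof safe
      fix x w assume x: "x \<in> I"
      have "eventually (\<lambda>i. x \<in> fst i) \<Phi>"
        by (rule eventually_compose_filterlim[OF _ fst_lim])
          (use x in \<open>auto simp: eventually_finite_subsets_at_top intro!: exI[of _ "{x}"]\<close>)
      with ev_good have "eventually (\<lambda>i. (norm (x w - S i (x w)))\<^sup>2 \<le> 1 / real (Suc (snd i)) * (norm w)\<^sup>2) \<Phi>"
        by eventually_elim (simp add: good_def)
      moreover have "((\<lambda>i. 1 / real (Suc (snd i)) * (norm w)\<^sup>2) \<longlongrightarrow> 0) \<Phi>"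
        by (rule tendsto_mult_left_zero[OF filterlim_compose[OF LIMSEQ_Suc[OF lim_1_over_n] snd_lim]])
      ultimately have "((\<lambda>i. (norm (x w - S i (x w)))\<^sup>2) \<longlongrightarrow> 0) \<Phi>"
        by (rule tendsto_sandwich[OF always_eventually _ tendsto_const, rotated]) simp
      then have "((\<lambda>i. sqrt ((norm (x w - S i (x w)))\<^sup>2)) \<longlongrightarrow> sqrt 0) \<Phi>"
        by (rule tendsto_real_sqrt)
      then have "((\<lambda>i. S i (x w) - x w) \<longlongrightarrow> 0) \<Phi>"
        by (simp add: norm_minus_commute[of "x w"] tendsto_norm_zero_iff)
      then show "x w \<in> V"
        unfolding V_def by (simp add: LIM_zero_iff)
    qed
    show "closed V"
      unfolding closure_subset_eq[symmetric]
    proof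
      fix v assume v: "v \<in> closure V"
      have "((\<lambda>i. S i v) \<longlongrightarrow> v) \<Phi>"
      proof (rule tendstoI)
        fix r :: real assume "r > 0"
        then have "r / 2 > 0"
          by simp
        with v obtain k where k: "k \<in> V" "dist k v < r / 2"
          unfolding closure_approachable by blast
        from k(1) have "((\<lambda>i. S i k) \<longlongrightarrow> k) \<Phi>"
          by (simp add: V_def)
        from tendstoD[OF this \<open>r / 2 > 0\<close>]
        have "eventually (\<lambda>i. dist (S i k) k < r / 2) \<Phi>" .
        with ev_good show "eventually (\<lambda>i. dist (S i v) v < r) \<Phi>"
        proof eventually_elim
          case (elim i)
          have "norm ((v - k) - S i (v - k)) \<le> norm (v - k)"
            using elim(1) by (simp add: good_def)
          moreover have "v - S i v = ((v - k) - S i (v - k)) + (k - S i k)"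
            by (simp add: blinfun.diff_right)
          then have "norm (v - S i v) \<le> norm ((v - k) - S i (v - k)) + norm (k - S i k)"
            by (metis norm_triangle_ineq)
          ultimately show ?case
            using k(2) elim(2) by (simp add: dist_norm norm_minus_commute)
        qed
      qed
      then show "v \<in> V"
        by (simp add: V_def)
    qed
  qed
  have lim: "((\<lambda>i. S i v) \<longlongrightarrow> e v) \<Phi>" for v
  proof -
    have "eventually (\<lambda>i. S i (e v) = S i v) \<Phi>"
      using ev_good
    proof eventually_elim
      case (elim i)
      have "cadjoint x (v - e v) = 0" if "x \<in> fst i" for x
      proof (rule cinner_eqI)
        fix w
        have "x \<in> I"
          using elim that by blast
        then have "x w \<in> K"
          by (intro GK) blast
        then have "cinner (x w) (v - e v) = 0"
          by (simp add: cinner.diff_right e(3))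
        then show "cinner w (cadjoint x (v - e v)) = cinner w 0"
          using \<open>x \<in> I\<close> I by (simp add: cinner_cadjoint bounded subset_iff cinner.zero_right)
      qed
      then have "S i (v - e v) = 0"
        using elim by (simp add: good_def)
      then show ?case
        by (simp add: blinfun.diff_right)
    qed
    moreover have "((\<lambda>i. S i (e v)) \<longlongrightarrow> e v) \<Phi>"
      using \<open>K \<subseteq> V\<close> e(2)[of v] by (auto simp: V_def)
    ultimately show ?thesis
      by (simp add: tendsto_cong)
  qed
  have "e \<in> M"
  proof (rule weak_limit_mem[of \<Phi> S])
    show "\<Phi> \<noteq> bot"
      by (simp add: \<Phi>_def prod_filter_eq_bot)
    show "((\<lambda>i. cinner (S i x) y) \<longlongrightarrow> cinner (e x) y) \<Phi>" for x y
      by (rule cinner.tendsto[OF lim tendsto_const])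
  qed (rule SM e)+
  with e that show ?thesis
    by blast
qed

text \<open>The projection onto the closed span of \<open>M b H\<close> lies in \<open>M\<close>; it lies in the commutant because
  \<open>M\<close> is closed under adjoints and leaves this subspace invariant. In a factor it is therefore a
  scalar, and if \<open>b \<noteq> 0\<close> the subspace is everything, on which \<open>a\<close> vanishes.\<close>

lemma factor_prime:
  assumes "factor M" and "a \<in> M" and b: "b \<in> M"
    and zero: "\<And>x. x \<in> M \<Longrightarrow> a o\<^sub>L x o\<^sub>L b = 0"
  shows "a = 0 \<or> b = 0"
proof (cases "b = 0")
  case False
  define I where "I = (\<lambda>x. x o\<^sub>L b) ` M"
  define G where "G = (\<Union>y\<in>I. range (blinfun_apply y))"
  define K where "K = closure (span G)"
  have I: "I \<subseteq> M"
    using b by (auto simp: I_def intro: compose_mem)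
  have subK: "subspace K"
    unfolding K_def by (intro subspace_closure subspace_span)
  have GK: "G \<subseteq> K"
    unfolding K_def by (rule order.trans[OF span_superset closure_subset])
  have G: "x (b w) \<in> G" if "x \<in> M" for x w
    unfolding G_def I_def using that by force
  have G_cases: "\<exists>x\<in>M. \<exists>w. g = x (b w)" if "g \<in> G" for g
    using that by (auto simp: G_def I_def)
  obtain e where eM: "e \<in> M" and eK: "\<And>v. e v \<in> K"
    and e: "\<And>k v. k \<in> K \<Longrightarrow> cinner k (e v) = cinner k v"
    using range_projection_mem[OF I K_def[unfolded G_def]] by blast
  have invariant: "T k \<in> K" if T: "T \<in> M" and k: "k \<in> K" for T k
    unfolding K_def
  proof (rule closure_span_invariant[OF blinfun.bounded_linear_right])
    fix g assume "g \<in> G"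
    then obtain x w where "x \<in> M" "g = x (b w)"
      using G_cases by blast
    then have "T g \<in> G"
      using G[OF compose_mem[OF T], of x w] by simp
    then show "T g \<in> closure (span G)"
      using GK K_def by blast
  qed (use k K_def in blast)
  have "e \<in> commutant M"
    unfolding commutant_def
  proof (intro CollectI conjI ballI blinfun_eqI)
    fix T v assume T: "T \<in> M"
    have "cinner k (e (T v)) = cinner k (T (e v))" if k: "k \<in> K" for k
    proof -
      have "cinner k (T u) = cinner (cadjoint T k) u" for u
        using T by (simp add: cinner_cadjoint_left bounded)
      then show ?thesis
        using e k invariant[OF cadjoint_mem[OF T] k] by simp
    qed
    then have "e (T v) = T (e v)"
      by (intro orthogonal_unique[OF subK]) (simp_all add: eK invariant T)
    then show "(e o\<^sub>L T) v = (T o\<^sub>L e) v"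
      by simp
  qed (rule bounded[OF eM])
  with eM \<open>factor M\<close> obtain c where c: "e = scaleC_op c id_blinfun"
    unfolding factor_def scalar_operators_def by blast
  obtain w where w: "b w \<noteq> 0"
    using False by (metis blinfun_eqI zero_blinfun.rep_eq)
  have "b w \<in> K"
    using G[OF one_mem, of w] GK by auto
  then have "e (b w) = b w"
    by (intro orthogonal_unique[OF subK]) (simp_all add: eK e)
  then have "(c - 1) *\<^sub>C b w + b w = b w"
    unfolding c by (metis (no_types) blinfun_apply_id_blinfun diff_add_cancel id_apply scaleC_add_left
        scaleC_of_real of_real_1 scaleR_one scaleC_op_apply)
  then have "norm ((c - 1) *\<^sub>C b w) = 0"
    by simp
  then have "c = 1"
    using w by (simp add: norm_scaleC)
  then have "e v = v" for v
    unfolding c using scaleC_of_real[of 1 v] by simp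
  then have "v \<in> K" for v
    using eK[of v] by simp
  moreover have "K \<subseteq> {v. a v = 0}"
    unfolding K_def
  proof (rule closure_span_minimal)
    show "G \<subseteq> {v. a v = 0}"
    proof
      fix g assume "g \<in> G"
      then obtain x w where "x \<in> M" "g = x (b w)"
        using G_cases by blast
      then show "g \<in> {v. a v = 0}"
        using arg_cong[OF zero[of x], of "\<lambda>T. T w"] by simp
    qed
    show "subspace {v. a v = 0}"
      by (simp add: subspace_def blinfun.bilinear_simps)
    show "closed {v. a v = 0}"
      by (intro closed_Collect_eq continuous_intros)
  qed
  ultimately have "a = 0"
    by (intro blinfun_eqI) auto
  then show ?thesis ..
qed simp

end

section \<open>Products of inner derivations\<close>

definition ad :: "('h :: complex_hilbert \<Rightarrow>\<^sub>L 'h) \<Rightarrow> ('h \<Rightarrow>\<^sub>L 'h) \<Rightarrow> 'h \<Rightarrow>\<^sub>L 'h"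
  where "ad A X = (A o\<^sub>L X) - (X o\<^sub>L A)"

lemma ad_apply: "ad A X v = A (X v) - X (A v)"
  by (simp add: ad_def blinfun.diff_left)

lemma ad_add: "ad A (X + Y) = ad A X + ad A Y"
  by (rule blinfun_eqI) (simp add: ad_apply blinfun.bilinear_simps)

lemma ad_compose: "ad A (X o\<^sub>L Y) = (ad A X o\<^sub>L Y) + (X o\<^sub>L ad A Y)"
  by (rule blinfun_eqI) (simp add: ad_apply blinfun.bilinear_simps)

lemma ad_scaleC: "A \<in> bounded_operators \<Longrightarrow> ad A (scaleC_op c X) = scaleC_op c (ad A X)"
  by (rule blinfun_eqI)
    (simp add: ad_apply bounded_operatorsD linear_diff[OF bounded_linear.linear[OF bounded_linear_scaleC]])

context vn_algebra
begin

lemma ad_mem: "A \<in> M \<Longrightarrow> X \<in> M \<Longrightarrow> ad A X \<in> M"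
  unfolding ad_def by (intro diff_mem compose_mem)

text \<open>The Leibniz rule for \<open>ad C (T Y)\<close> turns the hypothesis into \<open>a T ad C Y = 0\<close> for all \<open>T\<close>, to
  which primeness applies.\<close>

lemma left_annihilator_ad:
  assumes "factor M" and a: "a \<in> M" and C: "C \<in> M"
    and zero: "\<And>Y. Y \<in> M \<Longrightarrow> a o\<^sub>L ad C Y = 0"
  shows "a = 0 \<or> (\<forall>Y\<in>M. ad C Y = 0)"
proof -
  have "a = 0 \<or> ad C Y = 0" if Y: "Y \<in> M" for Y
  proof (rule factor_prime[OF \<open>factor M\<close> a ad_mem[OF C Y]])
    fix T assume T: "T \<in> M"
    have "a o\<^sub>L T o\<^sub>L ad C Y = (a o\<^sub>L ad C (T o\<^sub>L Y)) - ((a o\<^sub>L ad C T) o\<^sub>L Y)"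
      by (rule blinfun_eqI) (simp add: ad_compose blinfun.bilinear_simps)
    then show "a o\<^sub>L T o\<^sub>L ad C Y = 0"
      using zero[OF T] zero[OF compose_mem[OF T Y]]
      by (simp add: bounded_bilinear.zero_left[OF bounded_bilinear_blinfun_compose])
  qed
  then show ?thesis
    by blast
qed

text \<open>In the Leibniz expansion of \<open>ad B (ad A (X Y))\<close> the two outer terms vanish, so the mixed ones
  cancel.\<close>

lemma ad_ad_leibniz:
  assumes zero: "\<And>X. X \<in> M \<Longrightarrow> ad B (ad A X) = 0" and X: "X \<in> M" and Y: "Y \<in> M"
  shows "(ad A X o\<^sub>L ad B Y) + (ad B X o\<^sub>L ad A Y) = 0"
proof -
  have "ad B (ad A (X o\<^sub>L Y)) = (ad B (ad A X) o\<^sub>L Y) + ((ad A X o\<^sub>L ad B Y) + (ad B X o\<^sub>L ad A Y))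
      + (X o\<^sub>L ad B (ad A Y))"
    by (simp only: ad_compose ad_add add.assoc)
  then show ?thesis
    using zero[OF X] zero[OF Y] zero[OF compose_mem[OF X Y]]
    by (simp add: bounded_bilinear.zero_left[OF bounded_bilinear_blinfun_compose]
        bounded_bilinear.zero_right[OF bounded_bilinear_blinfun_compose])
qed

text \<open>This is Posner's argument for prime rings. Substituting \<open>ad A Z\<close> for \<open>X\<close> in
  \<open>ad A X \<cdot> ad B Y + ad B X \<cdot> ad A Y = 0\<close> kills the second term and leaves
  \<open>(ad A)\<^sup>2 Z \<cdot> ad B Y = 0\<close>, so that \<open>ad B = 0\<close> or \<open>(ad A)\<^sup>2 = 0\<close>. In the second case the same
  identity with \<open>B = A\<close> reads \<open>2 ad A X \<cdot> ad A Y = 0\<close>, and \<open>ad A = 0\<close>.\<close>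

lemma posner:
  assumes "factor M" and A: "A \<in> M" and B: "B \<in> M"
    and zero: "\<And>X. X \<in> M \<Longrightarrow> ad B (ad A X) = 0"
  shows "(\<forall>X\<in>M. ad A X = 0) \<or> (\<forall>X\<in>M. ad B X = 0)"
proof (cases "\<forall>Z\<in>M. ad A (ad A Z) = 0")
  case False
  then obtain Z where Z: "Z \<in> M" and "ad A (ad A Z) \<noteq> 0"
    by blast
  have "ad A (ad A Z) o\<^sub>L ad B Y = 0" if "Y \<in> M" for Y
    using ad_ad_leibniz[OF zero ad_mem[OF A Z] that]
    by (simp add: zero[OF Z] bounded_bilinear.zero_left[OF bounded_bilinear_blinfun_compose])
  with left_annihilator_ad[OF \<open>factor M\<close> ad_mem[OF A ad_mem[OF A Z]] B] \<open>ad A (ad A Z) \<noteq> 0\<close>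
  show ?thesis
    by blast
next
  case True
  have "ad A X o\<^sub>L ad A Y = 0" if X: "X \<in> M" and Y: "Y \<in> M" for X Y
  proof -
    have "2 *\<^sub>R (ad A X o\<^sub>L ad A Y) = 0"
      unfolding scaleR_2 by (rule ad_ad_leibniz) (use True X Y in blast)+
    then show ?thesis
      by simp
  qed
  then show ?thesis
    using left_annihilator_ad[OF \<open>factor M\<close> ad_mem[OF A] A] by blast
qed

section \<open>Differentiating along unitaries\<close>

definition skew_adjoint :: "('h \<Rightarrow>\<^sub>L 'h) \<Rightarrow> bool"
  where "skew_adjoint K \<longleftrightarrow> (\<forall>x y. cinner (K x) y = - cinner x (K y))"

lemma skew_adjoint_scaleR: "skew_adjoint K \<Longrightarrow> skew_adjoint (r *\<^sub>R K)"
  by (simp add: skew_adjoint_def blinfun.scaleR_left cinner.scaleR_left cinner.scaleR_right)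

text \<open>Skew-adjointness gives \<open>Re \<langle>(I - K) x, x\<rangle> = \<parallel>x\<parallel>\<^sup>2\<close>: the operator \<open>I - K\<close> is coercive with
  constant 1, whatever the norm of \<open>K\<close>, and its inverse is a contraction.\<close>

lemma skew_resolvent:
  assumes K: "K \<in> M" and skew: "skew_adjoint K"
  obtains R where "R \<in> M" and "\<And>x. R x - K (R x) = x" and "\<And>x. R x - R (K x) = x"
    and "norm (R - id_blinfun) \<le> norm K"
proof -
  define T where "T = id_blinfun - K"
  have TM: "T \<in> M"
    unfolding T_def by (intro diff_mem one_mem K)
  have T_apply: "T x = x - K x" for x
    by (simp add: T_def blinfun.diff_left)
  have "1 * (norm x)\<^sup>2 \<le> Re (cinner (T x) x)" for x
  proof -
    have "cinner (K x) x = - cnj (cinner (K x) x)"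
      using skew cinner_commute[of x "K x"] by (simp add: skew_adjoint_def)
    then have "Re (cinner (K x) x) = 0"
      by (simp add: complex_eq_iff)
    then show ?thesis
      by (simp add: T_apply cinner.diff_left Re_cinner_self)
  qed
  then obtain R where R: "R \<in> M" "T o\<^sub>L R = id_blinfun" "R o\<^sub>L T = id_blinfun"
    and contr: "\<And>x. 1 * norm (R x) \<le> norm x"
    using coercive_invertible[OF TM zero_less_one] by metis
  have TR: "R x - K (R x) = x" and RT: "R x - R (K x) = x" for x
    using arg_cong[OF R(2), of "\<lambda>Y. Y x"] arg_cong[OF R(3), of "\<lambda>Y. Y x"]
    by (simp_all add: T_apply blinfun.diff_right)
  have "norm (R - id_blinfun) \<le> norm K"
  proof (rule norm_blinfun_bound)
    fix x
    have "(R - id_blinfun) x = K (R x)"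
      using TR[of x] by (simp add: blinfun.diff_left algebra_simps)
    then have "norm ((R - id_blinfun) x) \<le> norm K * norm (R x)"
      by (simp add: norm_blinfun)
    also have "\<dots> \<le> norm K * norm x"
      using contr[of x] by (intro mult_left_mono) simp_all
    finally show "norm ((R - id_blinfun) x) \<le> norm K * norm x" .
  qed simp
  with R(1) TR RT that show ?thesis
    by blast
qed

text \<open>\<open>R\<close> and \<open>R'\<close> are the inverses of \<open>I - K\<close> and \<open>I + K\<close>, which are adjoint to each other, and
  \<open>U = (I + K) R\<close>. With \<open>t K\<close> in place of \<open>K\<close> the formulas for \<open>U\<close> and \<open>U\<^sup>*\<close> and the bounds are
  first order expansions at \<open>t = 0\<close> of a curve of unitaries with velocity \<open>2 K\<close>; unlike \<open>exp (t K)\<close>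
  it needs no power series.\<close>

lemma cayley_transform:
  assumes K: "K \<in> M" and skew: "skew_adjoint K"
  obtains U R R' where "U \<in> unitaries M"
    and "U = id_blinfun + 2 *\<^sub>R (K o\<^sub>L R)" and "cadjoint U = id_blinfun - 2 *\<^sub>R (K o\<^sub>L R')"
    and "norm (R - id_blinfun) \<le> norm K" and "norm (R' - id_blinfun) \<le> norm K"
proof -
  obtain R where RM: "R \<in> M" and KR: "\<And>x. R x - K (R x) = x" and RK: "\<And>x. R x - R (K x) = x"
    and R_norm: "norm (R - id_blinfun) \<le> norm K"
    using skew_resolvent[OF K skew] by metis
  have "(- 1) *\<^sub>R K \<in> M" "skew_adjoint ((- 1) *\<^sub>R K)"
    by (intro scaleR_mem skew_adjoint_scaleR K skew)+
  from skew_resolvent[OF this]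
  obtain R' where "R' \<in> M" and "\<And>x. R' x - ((- 1) *\<^sub>R K) (R' x) = x"
    and "\<And>x. R' x - R' (((- 1) *\<^sub>R K) x) = x" and "norm (R' - id_blinfun) \<le> norm ((- 1) *\<^sub>R K)"
    by metis
  then have KR': "R' x + K (R' x) = x" and R'K: "R' x + R' (K x) = x"
    and R'_norm: "norm (R' - id_blinfun) \<le> norm K" for x
    by (simp_all add: blinfun.minus_left blinfun.minus_right)
  define U where "U = id_blinfun + 2 *\<^sub>R (K o\<^sub>L R)"
  define V where "V = id_blinfun - 2 *\<^sub>R (K o\<^sub>L R')"
  have U_apply: "U x = R x + K (R x)" for x
    using KR[of x] by (simp add: U_def blinfun.bilinear_simps scaleR_2 algebra_simps)
  have V_apply: "V x = R' x - K (R' x)" for x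
    using KR'[of x] by (simp add: V_def blinfun.bilinear_simps scaleR_2 algebra_simps)
  have V_apply': "V x = R' (x - K x)" for x
  proof -
    have "R' (K x) = K (R' x)"
      using KR'[of x] R'K[of x] by (metis add_left_cancel)
    then show ?thesis
      by (simp add: V_apply blinfun.diff_right)
  qed
  have adj: "cinner x (y + K y) = cinner (x - K x) y" for x y
    using skew by (simp add: skew_adjoint_def cinner.add_right cinner.diff_left)
  have adj': "cinner (x + K x) y = cinner x (y - K y)" for x y
    using skew by (simp add: skew_adjoint_def cinner.add_left cinner.diff_right)
  have R_adj: "cinner (R x) y = cinner x (R' y)" for x y
    using adj[of "R x" "R' y"] by (simp add: KR KR')
  have "cadjoint U = V"
    by (rule cadjoint_eqI) (simp add: U_apply V_apply' adj' R_adj)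
  moreover have "V o\<^sub>L U = id_blinfun"
  proof (rule blinfun_eqI)
    fix x
    have "R' (R x + K (R x)) = R x"
      by (simp add: blinfun.add_right R'K)
    then show "(V o\<^sub>L U) x = id_blinfun x"
      by (simp add: V_apply U_apply KR)
  qed
  moreover have "U o\<^sub>L V = id_blinfun"
  proof (rule blinfun_eqI)
    fix x
    have "R (R' x - K (R' x)) = R' x"
      by (simp add: blinfun.diff_right RK)
    then show "(U o\<^sub>L V) x = id_blinfun x"
      by (simp add: V_apply U_apply KR')
  qed
  moreover have "U \<in> M"
    unfolding U_def by (intro add_mem scaleR_mem compose_mem one_mem K RM)
  ultimately have "U \<in> unitaries M"
    by (simp add: unitaries_def)
  with that[OF _ U_def] \<open>cadjoint U = V\<close> V_def R_norm R'_norm show ?thesis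
    by blast
qed

text \<open>Along the Cayley transforms \<open>U\<close> of \<open>t K\<close> the difference \<open>U A U\<^sup>* - A\<close> equals \<open>2 t D\<close> with
  \<open>D = K R A U\<^sup>* - A K R'\<close>. Both \<open>U A U\<^sup>*\<close> and \<open>A\<close> (the case of
  the unitary \<open>I\<close>) commute with \<open>B\<close>. So \<open>D\<close> commutes with \<open>B\<close>, and \<open>D\<close> tends to \<open>K A - A K\<close> as
  \<open>t\<close> tends to 0.\<close>

lemma ad_ad_skew_adjoint:
  assumes A: "A \<in> M" and B: "B \<in> M" and K: "K \<in> M" and skew: "skew_adjoint K"
    and comm: "\<And>U. U \<in> unitaries M \<Longrightarrow>
      U o\<^sub>L A o\<^sub>L cadjoint U o\<^sub>L B = B o\<^sub>L U o\<^sub>L A o\<^sub>L cadjoint U"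
  shows "ad B (ad A K) = 0"
proof -
  have "cadjoint (id_blinfun :: 'h \<Rightarrow>\<^sub>L 'h) = id_blinfun"
    by (rule cadjoint_eqI) simp
  then have "id_blinfun \<in> unitaries M"
    using one_mem by (auto simp: unitaries_def intro!: blinfun_eqI)
  from arg_cong[OF comm[OF this], of blinfun_apply] have AB: "A (B x) = B (A x)" for x
    by (simp add: \<open>cadjoint id_blinfun = id_blinfun\<close> fun_eq_iff)
  define t where "t n = 1 / real (Suc n)" for n
  have t_lim: "t \<longlonglongrightarrow> 0"
    unfolding t_def by (rule LIMSEQ_Suc[OF lim_1_over_n])
  have "\<exists>U R R'. U \<in> unitaries M
    \<and> U = id_blinfun + 2 *\<^sub>R ((t n *\<^sub>R K) o\<^sub>L R) \<and> cadjoint U = id_blinfun - 2 *\<^sub>R ((t n *\<^sub>R K) o\<^sub>L R')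
    \<and> norm (R - id_blinfun) \<le> norm (t n *\<^sub>R K) \<and> norm (R' - id_blinfun) \<le> norm (t n *\<^sub>R K)" for n
    using cayley_transform[OF scaleR_mem[OF K] skew_adjoint_scaleR[OF skew], of "t n"] by metis
  then obtain U R R' where UM: "\<And>n. U n \<in> unitaries M"
    and U: "\<And>n. U n = id_blinfun + 2 *\<^sub>R ((t n *\<^sub>R K) o\<^sub>L R n)"
    and V: "\<And>n. cadjoint (U n) = id_blinfun - 2 *\<^sub>R ((t n *\<^sub>R K) o\<^sub>L R' n)"
    and R_norm: "\<And>n. norm (R n - id_blinfun) \<le> norm (t n *\<^sub>R K)"
    and R'_norm: "\<And>n. norm (R' n - id_blinfun) \<le> norm (t n *\<^sub>R K)"
    by metis
  note compose_lim = bounded_bilinear.tendsto[OF bounded_bilinear_blinfun_compose]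
  have tK_lim: "(\<lambda>n. t n *\<^sub>R K) \<longlonglongrightarrow> 0"
    using tendsto_scaleR[OF t_lim tendsto_const[of K]] by simp
  have lim_id: "X \<longlonglongrightarrow> id_blinfun" if "\<And>n. norm (X n - id_blinfun) \<le> norm (t n *\<^sub>R K)"
    for X :: "nat \<Rightarrow> 'h \<Rightarrow>\<^sub>L 'h"
    by (rule LIM_zero_cancel, rule Lim_null_comparison[OF _ tendsto_norm_zero[OF tK_lim]])
      (simp only: that eventually_sequentially, blast)
  have R_lim: "R \<longlonglongrightarrow> id_blinfun" and R'_lim: "R' \<longlonglongrightarrow> id_blinfun"
    by (rule lim_id[OF R_norm] lim_id[OF R'_norm])+
  have V_lim: "(\<lambda>n. cadjoint (U n)) \<longlonglongrightarrow> id_blinfun"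
  proof -
    have "(\<lambda>n. id_blinfun - 2 *\<^sub>R ((t n *\<^sub>R K) o\<^sub>L R' n)) \<longlonglongrightarrow> id_blinfun - 2 *\<^sub>R (0 o\<^sub>L id_blinfun)"
      by (rule tendsto_diff[OF tendsto_const tendsto_scaleR[OF tendsto_const compose_lim[OF tK_lim R'_lim]]])
    then show ?thesis
      unfolding V by (simp add: bounded_bilinear.zero_left[OF bounded_bilinear_blinfun_compose])
  qed
  define D where "D n = (K o\<^sub>L R n o\<^sub>L A o\<^sub>L cadjoint (U n)) - (A o\<^sub>L K o\<^sub>L R' n)" for n
  have "D \<longlonglongrightarrow> (K o\<^sub>L id_blinfun o\<^sub>L A o\<^sub>L id_blinfun) - (A o\<^sub>L K o\<^sub>L id_blinfun)"
    unfolding D_def by (rule tendsto_diff compose_lim tendsto_const R_lim R'_lim V_lim)+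
  also have "(K o\<^sub>L id_blinfun o\<^sub>L A o\<^sub>L id_blinfun) - (A o\<^sub>L K o\<^sub>L id_blinfun) = - ad A K"
    by (rule blinfun_eqI) (simp add: ad_apply blinfun.bilinear_simps)
  finally have D_lim: "D \<longlonglongrightarrow> - ad A K" .
  have "D n o\<^sub>L B = B o\<^sub>L D n" for n
  proof (rule blinfun_eqI)
    fix x
    have D: "U n (A (cadjoint (U n) x)) = A x + (2 * t n) *\<^sub>R D n x" for x
    proof -
      have "U n (A (cadjoint (U n) x))
          = A (cadjoint (U n) x) + (2 * t n) *\<^sub>R K (R n (A (cadjoint (U n) x)))"
        by (subst U) (simp add: blinfun.bilinear_simps)
      moreover have "A (cadjoint (U n) x) = A x - (2 * t n) *\<^sub>R A (K (R' n x))"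
        by (simp add: V blinfun.bilinear_simps)
      ultimately show ?thesis
        by (simp add: D_def blinfun.bilinear_simps scaleR_diff_right)
    qed
    have "U n (A (cadjoint (U n) (B x))) = B (U n (A (cadjoint (U n) x)))"
      using arg_cong[OF comm[OF UM[of n]], of "\<lambda>Y. Y x"] by simp
    then have "(2 * t n) *\<^sub>R D n (B x) = (2 * t n) *\<^sub>R B (D n x)"
      unfolding D by (simp add: blinfun.bilinear_simps AB)
    then show "(D n o\<^sub>L B) x = (B o\<^sub>L D n) x"
      by (simp add: t_def)
  qed
  then have "(- ad A K) o\<^sub>L B = B o\<^sub>L (- ad A K)"
    using compose_lim[OF D_lim tendsto_const[of B]] compose_lim[OF tendsto_const[of B] D_lim]
    by (simp add: LIMSEQ_unique)
  then have "ad A K (B x) = B (ad A K x)" for x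
    by (metis (no_types) blinfun_apply_blinfun_compose blinfun.minus_left blinfun.minus_right neg_equal_iff_equal)
  then show ?thesis
    by (intro blinfun_eqI) (simp add: ad_apply[of B])
qed

text \<open>Every operator in \<open>M\<close> is a complex combination of the skew-adjoint operators \<open>X - X\<^sup>*\<close> and
  \<open>\<i> (X + X\<^sup>*)\<close>.\<close>

lemma ad_ad_eq_0:
  assumes A: "A \<in> M" and B: "B \<in> M" and X: "X \<in> M"
    and comm: "\<And>U. U \<in> unitaries M \<Longrightarrow>
      U o\<^sub>L A o\<^sub>L cadjoint U o\<^sub>L B = B o\<^sub>L U o\<^sub>L A o\<^sub>L cadjoint U"
  shows "ad B (ad A X) = 0"
proof -
  note adj = cinner_cadjoint[OF bounded[OF X]] cinner_cadjoint_left[OF bounded[OF X]]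
  have "skew_adjoint (X - cadjoint X)"
    by (simp add: skew_adjoint_def blinfun.bilinear_simps cinner.diff_left cinner.diff_right adj)
  then have "ad B (ad A (X - cadjoint X)) = 0"
    by (intro ad_ad_skew_adjoint[OF A B _ _ comm] diff_mem cadjoint_mem X)
  moreover have "skew_adjoint (scaleC_op \<i> (X + cadjoint X))"
    by (simp add: skew_adjoint_def blinfun.bilinear_simps cinner_scaleC_left cinner_scaleC_right
        cinner.add_left cinner.add_right adj add.commute)
  then have "ad B (ad A (scaleC_op \<i> (X + cadjoint X))) = 0"
    by (intro ad_ad_skew_adjoint[OF A B _ _ comm] scaleC_mem add_mem cadjoint_mem X)
  then have zero: "scaleC_op \<i> (ad B (ad A (X + cadjoint X))) = 0"
    by (simp add: ad_scaleC bounded A B)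
  have "ad B (ad A (X + cadjoint X)) = 0"
  proof (rule blinfun_eqI)
    fix v
    have "norm (\<i> *\<^sub>C ad B (ad A (X + cadjoint X)) v) = 0"
      using arg_cong[OF zero, of "\<lambda>Y. norm (Y v)"] by simp
    then show "ad B (ad A (X + cadjoint X)) v = blinfun_apply 0 v"
      by (simp add: norm_scaleC)
  qed
  ultimately have "ad B (ad A ((X - cadjoint X) + (X + cadjoint X))) = 0"
    unfolding ad_add by simp
  moreover have "(X - cadjoint X) + (X + cadjoint X) = X + X"
    by simp
  ultimately have "2 *\<^sub>R ad B (ad A X) = 0"
    by (simp only: ad_add scaleR_2)
  then show ?thesis
    by simp
qed

section \<open>Operators commuting with a unitary orbit\<close>

lemma factor_central_scalar:
  assumes "factor M" and "A \<in> M" and "\<And>X. X \<in> M \<Longrightarrow> ad A X = 0"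
  shows "A \<in> scalar_operators"
proof -
  have "A \<in> commutant M"
    using assms(2,3) by (simp add: commutant_def bounded ad_def)
  with assms(1,2) show ?thesis
    by (auto simp: factor_def)
qed

end

theorem theorem1p1:
  fixes M :: "('h :: complex_hilbert \<Rightarrow>\<^sub>L 'h) set"
    and A B :: "'h \<Rightarrow>\<^sub>L 'h"
  assumes "factor M"
    and "separable_predual M"
    and "A \<in> M" and "B \<in> M"
    and "\<And>U. U \<in> unitaries M \<Longrightarrow>
      U o\<^sub>L A o\<^sub>L cadjoint U o\<^sub>L B = B o\<^sub>L U o\<^sub>L A o\<^sub>L cadjoint U"
  shows "A \<in> scalar_operators \<or> B \<in> scalar_operators"
proof -
  interpret vn_algebra M
    by standard (use assms(1) in \<open>simp add: factor_def\<close>)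
  have "ad B (ad A X) = 0" if "X \<in> M" for X
    by (rule ad_ad_eq_0[OF assms(3,4) that assms(5)])
  then have "(\<forall>X\<in>M. ad A X = 0) \<or> (\<forall>X\<in>M. ad B X = 0)"
    by (rule posner[OF assms(1,3,4)])
  then show ?thesis
    using factor_central_scalar[OF assms(1,3)] factor_central_scalar[OF assms(1,4)] by blast
qed

end
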